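(* Let $q=p^n>2$, where $p$ is a prime and $n$ is a positive integer. The spectrum of the commuting graph of the general linear group $GL(2,q)$ (over the field with $q$ elements) is $$\left\{(-1)^{q^4-q^3-2q^2-q},\ (q^2-3q+1)^{\frac{q(q+1)}{2}},\ (q^2-q-1)^{\frac{q(q-1)}{2}},\ (q^2-2q)^{q+1}\right\}.$$
   Context: For a finite non-abelian group $G$ with centre $Z(G)$, the commuting graph $\Gamma_G$ is the simple undirected graph with vertex set $G\setminus Z(G)$ in which two distinct vertices $x,y$ are adjacent if and only if $xy=yx$. The spectrum of a graph is the multiset of eigenvalues of its adjacency matrix, written $\{\lambda_1^{k_1},\dots,\lambda_r^{k_r}\}$, where $\lambda^{k}$ denotes that $\lambda$ is listed $k$ times (listed values may coincide, in which case multiplicities add). *)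

theory Defs
  imports
    "HOL-Algebra.Group"
    "HOL-Computational_Algebra.Computational_Algebra"
    "Jordan_Normal_Form.Char_Poly"
    "Graph_Theory.Pair_Digraph"
begin

definition group_centre :: "('g, 'r) monoid_scheme \<Rightarrow> 'g set" where
  "group_centre G = {z \<in> carrier G. \<forall>x \<in> carrier G. z \<otimes>\<^bsub>G\<^esub> x = x \<otimes>\<^bsub>G\<^esub> z}"

text \<open>
  A simple undirected graph is represented, as in \<^theory>\<open>Graph_Theory.Pair_Digraph\<close>, by a set of vertices together
  with the symmetric irreflexive relation of adjacency (locale \<^locale>\<open>pair_graph\<close>).
\<close>

definition commuting_graph :: "('g, 'r) monoid_scheme \<Rightarrow> 'g pair_pre_digraph" where
  "commuting_graph G =
     \<lparr> pverts = carrier G - group_centre G,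
       parcs = {(x, y). x \<in> carrier G - group_centre G \<and> y \<in> carrier G - group_centre G \<and>
                        x \<noteq> y \<and> x \<otimes>\<^bsub>G\<^esub> y = y \<otimes>\<^bsub>G\<^esub> x} \<rparr>"

lemma pair_graph_commuting_graph:
  assumes "finite (carrier G)"
  shows "pair_graph (commuting_graph G)"
proof unfold_locales
  show "finite (parcs (commuting_graph G))"
    by (rule finite_subset[of _ "carrier G \<times> carrier G"])
      (use assms in \<open>auto simp: commuting_graph_def\<close>)
  show "symmetric (with_proj (commuting_graph G))"
    by (auto simp: symmetric_def commuting_graph_def intro!: symI)
qed (use assms in \<open>auto simp: commuting_graph_def\<close>)

definition adjacency_matrix :: "'v pair_pre_digraph \<Rightarrow> 'v list \<Rightarrow> complex mat" where
  "adjacency_matrix \<Gamma> vs =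
     mat (length vs) (length vs) (\<lambda>(i, j). if (vs ! i, vs ! j) \<in> parcs \<Gamma> then 1 else 0)"

definition vertex_enumeration :: "'v pair_pre_digraph \<Rightarrow> 'v list \<Rightarrow> bool" where
  "vertex_enumeration \<Gamma> vs \<longleftrightarrow> distinct vs \<and> set vs = pverts \<Gamma>"

text \<open>
  Eigenvalues are counted with algebraic multiplicity.  The choice of the enumeration is
  immaterial, see \<open>graph_spectrum_eq\<close> below.
\<close>

definition graph_spectrum :: "'v pair_pre_digraph \<Rightarrow> complex multiset" where
  "graph_spectrum \<Gamma> =
     proots (char_poly (adjacency_matrix \<Gamma> (SOME vs. vertex_enumeration \<Gamma> vs)))"

lemma similar_adjacency_matrix:
  assumes xs: "vertex_enumeration \<Gamma> xs" and ys: "vertex_enumeration \<Gamma> ys"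
  shows "similar_mat (adjacency_matrix \<Gamma> xs) (adjacency_matrix \<Gamma> ys)"
proof -
  let ?n = "length xs"
  have dxs: "distinct xs" and dys: "distinct ys" and st: "set xs = set ys"
    using xs ys by (auto simp: vertex_enumeration_def)
  have len: "length ys = ?n"
    using dxs dys st by (metis distinct_card)
  obtain f where f: "\<And>i. i < ?n \<Longrightarrow> f i < ?n \<and> ys ! f i = xs ! i"
  proof -
    have "\<forall>i. \<exists>k. i < ?n \<longrightarrow> k < ?n \<and> ys ! k = xs ! i"
      using st len by (metis in_set_conv_nth)
    thus ?thesis using that by metis
  qed
  have f_iff: "xs ! i = ys ! k \<longleftrightarrow> k = f i" if "i < ?n" "k < ?n" for i k
    using that f[of i] dys len by (metis nth_eq_iff_index_eq)
  define P :: "complex mat" where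
    "P = mat ?n ?n (\<lambda>(i, k). if xs ! i = ys ! k then 1 else 0)"
  define Q :: "complex mat" where
    "Q = mat ?n ?n (\<lambda>(k, i). if xs ! i = ys ! k then 1 else 0)"
  let ?A = "adjacency_matrix \<Gamma> xs" and ?B = "adjacency_matrix \<Gamma> ys"
  have carr: "{?A, ?B, P, Q} \<subseteq> carrier_mat ?n ?n"
    using len by (auto simp: adjacency_matrix_def P_def Q_def)
  have PQ: "P * Q = 1\<^sub>m ?n"
  proof (rule eq_matI)
    fix i j assume ij: "i < dim_row (1\<^sub>m ?n :: complex mat)" "j < dim_col (1\<^sub>m ?n :: complex mat)"
    hence ij': "i < ?n" "j < ?n" by auto
    have "(P * Q) $$ (i, j) =
      (\<Sum>k = 0..<?n. (if xs ! i = ys ! k then 1 else 0) * (if xs ! j = ys ! k then 1 else 0))"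
      using ij' by (simp add: P_def Q_def scalar_prod_def)
    also have "\<dots> = (\<Sum>k = 0..<?n. if k = f i then (if f i = f j then 1 else 0) else 0)"
      using ij' by (intro sum.cong) (auto simp: f_iff)
    also have "\<dots> = (if f i = f j then 1 else 0)"
      using f[OF ij'(1)] by (subst sum.delta) auto
    also have "f i = f j \<longleftrightarrow> i = j"
      using f[OF ij'(1)] f[OF ij'(2)] dxs ij' by (metis nth_eq_iff_index_eq)
    finally show "(P * Q) $$ (i, j) = 1\<^sub>m ?n $$ (i, j)"
      using ij' by simp
  qed (auto simp: P_def Q_def)
  have QP: "Q * P = 1\<^sub>m ?n"
    using mat_mult_left_right_inverse[of P ?n Q] PQ carr by auto
  have "P * ?B * Q = ?A"
  proof (rule eq_matI)
    fix i j assume ij: "i < dim_row ?A" "j < dim_col ?A"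
    hence ij': "i < ?n" "j < ?n" by (auto simp: adjacency_matrix_def)
    have PB: "(P * ?B) $$ (i, k) = ?B $$ (f i, k)" if k: "k < ?n" for k
    proof -
      have "(P * ?B) $$ (i, k) = (\<Sum>l = 0..<?n. (if xs ! i = ys ! l then 1 else 0) * ?B $$ (l, k))"
        using ij' k len by (simp add: P_def adjacency_matrix_def scalar_prod_def)
      also have "\<dots> = (\<Sum>l = 0..<?n. if l = f i then ?B $$ (f i, k) else 0)"
        using ij' by (intro sum.cong) (auto simp: f_iff)
      also have "\<dots> = ?B $$ (f i, k)"
        using f[OF ij'(1)] by (subst sum.delta) auto
      finally show ?thesis .
    qed
    have "(P * ?B * Q) $$ (i, j) = (\<Sum>k = 0..<?n. (P * ?B) $$ (i, k) * Q $$ (k, j))"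
      using ij' carr by (auto simp: scalar_prod_def)
    also have "\<dots> = (\<Sum>k = 0..<?n. if k = f j then ?B $$ (f i, f j) else 0)"
      using ij' by (intro sum.cong) (auto simp: PB Q_def f_iff)
    also have "\<dots> = ?B $$ (f i, f j)"
      using f[OF ij'(2)] by (subst sum.delta) auto
    also have "\<dots> = ?A $$ (i, j)"
      using f[OF ij'(1)] f[OF ij'(2)] ij' len by (simp add: adjacency_matrix_def)
    finally show "(P * ?B * Q) $$ (i, j) = ?A $$ (i, j)" .
  qed (auto simp: P_def Q_def adjacency_matrix_def)
  thus ?thesis
    by (intro similar_matI[OF carr PQ QP]) simp
qed

lemma graph_spectrum_eq:
  assumes "vertex_enumeration \<Gamma> vs"
  shows "graph_spectrum \<Gamma> = proots (char_poly (adjacency_matrix \<Gamma> vs))"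
  unfolding graph_spectrum_def
  using char_poly_similar[OF similar_adjacency_matrix[OF someI[of "vertex_enumeration \<Gamma>", OF assms] assms]]
  by simp

definition general_linear_group :: "'k::field itself \<Rightarrow> nat \<Rightarrow> 'k mat monoid" where
  "general_linear_group K m = units_of (ring_mat K m ())"

lemma group_general_linear_group: "group (general_linear_group TYPE('k::field) m)"
  unfolding general_linear_group_def
  by (intro monoid.units_group ring.is_monoid ring_mat)

end

(*
  Two non-central elements of GL(2,q) commute iff their non-scalar parts are proportional, so the
  commuting graph is a disjoint union of cliques indexed by the points (a : b : c) of the projective
  plane of 2 x 2 matrices modulo scalars.  The clique of (a : b : c) consists of the invertible
  s (t I + [[a, b], [c, 0]]) with s non-zero.  The determinant is s^2 (t^2 + a t - b c), so the clique
  has (q - 1) (q - r) vertices, where r is the number of roots of t^2 + a t - b c.  The points with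
  c = 1 run over all monic quadratics, and counting quadratics together with their roots gives the
  number of cliques of each size.  A clique of size m contributes the eigenvalue m - 1 once and
  -1 with multiplicity m - 1.
*)
theory Submission
  imports Defs "HOL-Library.Cardinality"
begin

section \<open>Spectrum of a disjoint union of cliques\<close>

lemma char_poly_four_block_diag:
  fixes A B :: "'a::idom mat"
  assumes A: "A \<in> carrier_mat n n" and B: "B \<in> carrier_mat m m"
  shows "char_poly (four_block_mat A (0\<^sub>m n m) (0\<^sub>m m n) B) = char_poly A * char_poly B"
proof -
  have "char_poly_matrix (four_block_mat A (0\<^sub>m n m) (0\<^sub>m m n) B) =
      four_block_mat (char_poly_matrix A) (0\<^sub>m n m) (0\<^sub>m m n) (char_poly_matrix B)"
    using A B by (intro eq_matI) (auto simp: char_poly_matrix_def)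
  thus ?thesis
    using A B unfolding char_poly_def
    by (simp add: det_four_block_mat_lower_left_zero[of _ n _ m])
qed

lemma proots_prod_list_linear:
  "proots (\<Prod>a\<leftarrow>as. [:- a, 1:]) = mset (as :: 'a::idom list)"
proof (induction as)
  case (Cons a as)
  have "(\<Prod>a\<leftarrow>as. [:- a, 1:]) \<noteq> 0"
    by (auto simp: prod_list_zero_iff)
  with Cons show ?case by (simp add: proots_mult del: mult_pCons_left)
qed simp

lemma proots_char_poly_complete_graph:
  assumes n: "n > 0"
  shows "proots (char_poly (mat n n (\<lambda>(i, j). if i = j then 0 else 1) :: complex mat)) =
    add_mset (of_nat n - 1) (replicate_mset (n - 1) (- 1))"
proof -
  \<comment> \<open>The columns of \<open>P\<close> are the all-ones vector, an eigenvector of \<open>A\<close>, followed by unit vectors;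
    in this basis \<open>A\<close> becomes the upper triangular matrix \<open>B\<close>.\<close>
  define A :: "complex mat" where "A = mat n n (\<lambda>(i, j). if i = j then 0 else 1)"
  define B :: "complex mat" where
    "B = mat n n (\<lambda>(i, j). if i = 0 then if j = 0 then of_nat n - 1 else 1 else if i = j then - 1 else 0)"
  define P :: "complex mat" where "P = mat n n (\<lambda>(i, j). of_bool (i = j) + of_bool (j = 0 \<and> i \<noteq> 0))"
  define Q :: "complex mat" where "Q = mat n n (\<lambda>(i, j). of_bool (i = j) - of_bool (j = 0 \<and> i \<noteq> 0))"
  have carr: "{A, B, P, Q} \<subseteq> carrier_mat n n"
    by (auto simp: A_def B_def P_def Q_def)
  \<comment> \<open>Left multiplication by \<open>P\<close> adds row 0 to every other row;
    \<open>Q\<close> subtracts it again, so \<open>Q\<close> is the inverse of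
    \<open>P\<close>.\<close>
  have P_mult: "(P * M) $$ (i, j) = M $$ (i, j) + of_bool (i \<noteq> 0) * M $$ (0, j)"
    if M: "M \<in> carrier_mat n n" and ij: "i < n" "j < n" for M i j
  proof -
    have "(P * M) $$ (i, j) = (\<Sum>k = 0..<n. (of_bool (i = k) + of_bool (k = 0 \<and> i \<noteq> 0)) * M $$ (k, j))"
      using M ij by (simp add: P_def scalar_prod_def)
    also have "\<dots> = (\<Sum>k = 0..<n. if k = i then M $$ (i, j) else 0) +
        (\<Sum>k = 0..<n. if k = 0 then of_bool (i \<noteq> 0) * M $$ (0, j) else 0)"
      unfolding sum.distrib[symmetric] by (intro sum.cong) auto
    finally show ?thesis using ij n by (simp add: sum.delta)
  qed
  have PQ: "P * Q = 1\<^sub>m n"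
  proof (rule eq_matI)
    fix i j assume "i < dim_row (1\<^sub>m n :: complex mat)" "j < dim_col (1\<^sub>m n :: complex mat)"
    hence ij: "i < n" "j < n" by auto
    have "(P * Q) $$ (i, j) = Q $$ (i, j) + of_bool (i \<noteq> 0) * Q $$ (0, j)"
      using ij carr by (intro P_mult) auto
    thus "(P * Q) $$ (i, j) = 1\<^sub>m n $$ (i, j)"
      using ij n by (auto simp: Q_def)
  qed (auto simp: P_def Q_def)
  have QP: "Q * P = 1\<^sub>m n"
    using mat_mult_left_right_inverse[of P n Q] PQ carr by auto
  have "A * P = P * B"
  proof (rule eq_matI)
    fix i j assume "i < dim_row (P * B)" "j < dim_col (P * B)"
    hence ij: "i < n" "j < n" by (auto simp: P_def B_def)
    have "(A * P) $$ (i, j) =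
        (\<Sum>k = 0..<n. (if i = k then 0 else 1) * (of_bool (k = j) + of_bool (j = 0 \<and> k \<noteq> 0)))"
      using ij by (simp add: A_def P_def scalar_prod_def)
    also have "\<dots> = (if j = 0 then of_nat n - 1 else of_bool (i \<noteq> j))"
    proof (cases "j = 0")
      case True
      \<comment> \<open>Column 0 of \<open>P\<close> is the all-ones vector, so this is a row sum of
        \<open>A\<close>: \<open>n\<close> ones less the one missing on the diagonal.\<close>
      have "(\<Sum>k = 0..<n. (if i = k then 0 else 1) * (of_bool (k = j) + of_bool (j = 0 \<and> k \<noteq> 0))) =
          (\<Sum>k = 0..<n. 1 - (if k = i then 1 else 0 :: complex))"
        using True by (intro sum.cong) auto
      also have "\<dots> = of_nat n - 1"
        using ij unfolding sum_subtractf by (simp add: sum.delta)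
      finally show ?thesis using True by simp
    next
      case False
      have "(\<Sum>k = 0..<n. (if i = k then 0 else 1) * (of_bool (k = j) + of_bool (j = 0 \<and> k \<noteq> 0))) =
          (\<Sum>k = 0..<n. (if k = j then of_bool (i \<noteq> j) else 0 :: complex))"
        using False by (intro sum.cong) auto
      thus ?thesis using False ij by (simp add: sum.delta)
    qed
    also have "\<dots> = B $$ (i, j) + of_bool (i \<noteq> 0) * B $$ (0, j)"
      using ij n by (auto simp: B_def)
    also have "\<dots> = (P * B) $$ (i, j)"
      using ij carr by (intro P_mult[symmetric]) auto
    finally show "(A * P) $$ (i, j) = (P * B) $$ (i, j)" .
  qed (auto simp: A_def P_def B_def)
  hence "A * P * Q = P * B * Q"
    by simp
  hence "A = P * B * Q"
    using PQ carr by (simp add: assoc_mult_mat[of A n n P n Q n] right_mult_one_mat[of A n n])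
  hence "similar_mat A B"
    by (intro similar_matI[OF carr PQ QP])
  moreover have "upper_triangular B"
    by (auto simp: B_def)
  ultimately have "proots (char_poly A) = proots (\<Prod>a\<leftarrow>diag_mat B. [:- a, 1:])"
    using char_poly_similar[of A B] char_poly_upper_triangular[of B n] carr by simp
  also have "diag_mat B = (of_nat n - 1) # replicate (n - 1) (- 1)"
    using n by (intro nth_equalityI) (auto simp: diag_mat_def B_def nth_Cons split: nat.split)
  also have "proots (\<Prod>a\<leftarrow>(of_nat n - 1) # replicate (n - 1) (- 1). [:- a, 1:]) =
      mset ((of_nat n - 1) # replicate (n - 1) (- 1 :: complex))"
    by (rule proots_prod_list_linear)
  also have "\<dots> = add_mset (of_nat n - 1) (replicate_mset (n - 1) (- 1))"
    by simp
  finally show ?thesis by (simp add: A_def)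
qed

lemma adjacency_matrix_append:
  assumes "\<And>x y. x \<in> set xs \<Longrightarrow> y \<in> set ys \<Longrightarrow> (x, y) \<notin> parcs \<Gamma> \<and> (y, x) \<notin> parcs \<Gamma>"
  shows "adjacency_matrix \<Gamma> (xs @ ys) =
    four_block_mat (adjacency_matrix \<Gamma> xs) (0\<^sub>m (length xs) (length ys))
      (0\<^sub>m (length ys) (length xs)) (adjacency_matrix \<Gamma> ys)"
  using assms by (intro eq_matI) (auto simp: adjacency_matrix_def nth_append)

lemma proots_char_poly_clique:
  assumes "distinct xs" "xs \<noteq> []"
    and "\<And>x y. x \<in> set xs \<Longrightarrow> y \<in> set xs \<Longrightarrow> (x, y) \<in> parcs \<Gamma> \<longleftrightarrow> x \<noteq> y"
  shows "proots (char_poly (adjacency_matrix \<Gamma> xs)) =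
    add_mset (of_nat (length xs) - 1) (replicate_mset (length xs - 1) (- 1))"
proof -
  have "adjacency_matrix \<Gamma> xs = mat (length xs) (length xs) (\<lambda>(i, j). if i = j then 0 else 1)"
    using assms(1,3) by (intro eq_matI) (auto simp: adjacency_matrix_def nth_eq_iff_index_eq)
  thus ?thesis
    using proots_char_poly_complete_graph[of "length xs"] assms(2) by simp
qed

lemma adjacency_matrix_carrier: "adjacency_matrix \<Gamma> xs \<in> carrier_mat (length xs) (length xs)"
  by (simp add: adjacency_matrix_def)

text \<open>Needed because \<open>proots\<close> is known to turn a product into a sum only for
  nonzero factors.\<close>

lemma char_poly_nonzero: "A \<in> carrier_mat n n \<Longrightarrow> char_poly (A :: complex mat) \<noteq> 0"
  using degree_monic_char_poly[of A n] by auto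

text \<open>Listing the vertices clique after clique makes the adjacency matrix block diagonal, so
  its characteristic polynomial is the product of those of the complete graphs.\<close>

lemma graph_spectrum_disjoint_cliques:
  assumes fin: "finite I" "\<And>i. i \<in> I \<Longrightarrow> finite (B i)"
    and ne: "\<And>i. i \<in> I \<Longrightarrow> B i \<noteq> {}"
    and disj: "\<And>i j. i \<in> I \<Longrightarrow> j \<in> I \<Longrightarrow> i \<noteq> j \<Longrightarrow> B i \<inter> B j = {}"
    and verts: "pverts \<Gamma> = (\<Union>i\<in>I. B i)"
    and arcs: "\<And>i j x y. i \<in> I \<Longrightarrow> j \<in> I \<Longrightarrow> x \<in> B i \<Longrightarrow> y \<in> B j \<Longrightarrow>
      (x, y) \<in> parcs \<Gamma> \<longleftrightarrow> i = j \<and> x \<noteq> y"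
  shows "graph_spectrum \<Gamma> =
    (\<Sum>i\<in>I. add_mset (of_nat (card (B i)) - 1) (replicate_mset (card (B i) - 1) (- 1)))"
proof -
  \<comment> \<open>The induction speaks of lists \<open>vs\<close> instead of
    \<open>graph_spectrum\<close>, since a subfamily \<open>J\<close> of the cliques need not
    exhaust the vertices.\<close>
  have "\<exists>vs. distinct vs \<and> set vs = (\<Union>i\<in>J. B i) \<and> proots (char_poly (adjacency_matrix \<Gamma> vs)) =
      (\<Sum>i\<in>J. add_mset (of_nat (card (B i)) - 1) (replicate_mset (card (B i) - 1) (- 1)))"
    if "finite J" "J \<subseteq> I" for J
    using that
  proof (induction J rule: finite_induct)
    case empty
    have "char_poly (adjacency_matrix \<Gamma> []) = 1"
      using adjacency_matrix_carrier[of \<Gamma> "[]"]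
      by (simp add: char_poly_def det_dim_zero[OF char_poly_matrix_closed])
    thus ?case by simp
  next
    case (insert i J)
    then obtain vs where vs: "distinct vs" "set vs = (\<Union>i\<in>J. B i)"
      "proots (char_poly (adjacency_matrix \<Gamma> vs)) =
        (\<Sum>i\<in>J. add_mset (of_nat (card (B i)) - 1) (replicate_mset (card (B i) - 1) (- 1)))"
      by auto
    have i: "i \<in> I" and J: "J \<subseteq> I" using insert.prems by auto
    obtain xs where xs: "distinct xs" "set xs = B i"
      using finite_distinct_list[OF fin(2)[OF i]] by auto
    have len: "length xs = card (B i)"
      using xs distinct_card by metis
    have "xs \<noteq> []"
      using xs ne[OF i] by auto
    hence clique: "proots (char_poly (adjacency_matrix \<Gamma> xs)) =
        add_mset (of_nat (card (B i)) - 1) (replicate_mset (card (B i) - 1) (- 1))"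
      using proots_char_poly_clique[of xs \<Gamma>] xs arcs[OF i i] len by auto
    have "(x, y) \<notin> parcs \<Gamma> \<and> (y, x) \<notin> parcs \<Gamma>" if "x \<in> set xs" "y \<in> set vs" for x y
    proof -
      from that obtain j where j: "j \<in> J" "y \<in> B j" "x \<in> B i" using xs vs by auto
      moreover have "j \<noteq> i" using insert.hyps j by auto
      ultimately show ?thesis using arcs[of i j x y] arcs[of j i y x] i J by auto
    qed
    hence "char_poly (adjacency_matrix \<Gamma> (xs @ vs)) =
        char_poly (adjacency_matrix \<Gamma> xs) * char_poly (adjacency_matrix \<Gamma> vs)"
      by (simp add: adjacency_matrix_append char_poly_four_block_diag adjacency_matrix_carrier)
    hence "proots (char_poly (adjacency_matrix \<Gamma> (xs @ vs))) =
        proots (char_poly (adjacency_matrix \<Gamma> xs)) + proots (char_poly (adjacency_matrix \<Gamma> vs))"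
      by (simp add: proots_mult char_poly_nonzero[OF adjacency_matrix_carrier])
    moreover have "distinct (xs @ vs)"
      using xs vs disj[OF i] J insert.hyps by auto
    ultimately show ?case
      using xs vs clique insert.hyps by (intro exI[of _ "xs @ vs"]) simp
  qed
  from this[OF fin(1)] obtain vs where "distinct vs" "set vs = (\<Union>i\<in>I. B i)"
    "proots (char_poly (adjacency_matrix \<Gamma> vs)) =
      (\<Sum>i\<in>I. add_mset (of_nat (card (B i)) - 1) (replicate_mset (card (B i) - 1) (- 1)))"
    by auto
  thus ?thesis
    using graph_spectrum_eq[of \<Gamma> vs] verts by (simp add: vertex_enumeration_def)
qed

section \<open>Invertible 2 x 2 matrices: products, commutation, centre\<close>

definition mat2 :: "'a \<Rightarrow> 'a \<Rightarrow> 'a \<Rightarrow> 'a \<Rightarrow> 'a mat" where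
  "mat2 a b c d = mat 2 2 (\<lambda>(i, j). if i = 0 then if j = 0 then a else b else if j = 0 then c else d)"

lemma mat2_carrier [simp]: "mat2 a b c d \<in> carrier_mat 2 2"
  by (simp add: mat2_def)

lemma mat2_index:
  "mat2 a b c d $$ (0, 0) = a" "mat2 a b c d $$ (0, 1) = b"
  "mat2 a b c d $$ (1, 0) = c" "mat2 a b c d $$ (1, 1) = d"
  by (simp_all add: mat2_def)

lemma mat2_eq_iff [simp]:
  "mat2 a b c d = mat2 a' b' c' d' \<longleftrightarrow> a = a' \<and> b = b' \<and> c = c' \<and> d = d'"
  by (metis mat2_index)

lemma carrier_mat2_cases:
  assumes "A \<in> carrier_mat 2 2"
  obtains a b c d where "A = mat2 a b c d"
proof
  show "A = mat2 (A $$ (0, 0)) (A $$ (0, 1)) (A $$ (1, 0)) (A $$ (1, 1))"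
    using assms by (intro eq_matI) (auto simp: mat2_def less_2_cases_iff)
qed

lemma mat2_mult:
  fixes a :: "'a::comm_ring_1"
  shows "mat2 a b c d * mat2 a' b' c' d' =
    mat2 (a * a' + b * c') (a * b' + b * d') (c * a' + d * c') (c * b' + d * d')"
proof -
  have "(\<Sum>i = 0..<2. f i) = f 0 + f 1" for f :: "nat \<Rightarrow> 'a"
    by (simp add: numeral_2_eq_2)
  thus ?thesis
    by (intro eq_matI) (auto simp: mat2_def scalar_prod_def less_2_cases_iff)
qed

lemma one_mat2: "1\<^sub>m 2 = mat2 1 0 0 (1 :: 'a::comm_ring_1)"
  by (intro eq_matI) (auto simp: mat2_def less_2_cases_iff)

lemma mult_general_linear_group: "x \<otimes>\<^bsub>general_linear_group K m\<^esub> y = x * y"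
  by (simp add: general_linear_group_def units_of_def ring_mat_simps)

lemma mat2_in_general_linear_group:
  fixes a b c d :: "'k::field"
  shows "mat2 a b c d \<in> carrier (general_linear_group TYPE('k) 2) \<longleftrightarrow> a * d - b * c \<noteq> 0"
proof
  assume "mat2 a b c d \<in> carrier (general_linear_group TYPE('k) 2)"
  then obtain B where B: "B \<in> carrier_mat 2 2" "mat2 a b c d * B = 1\<^sub>m 2"
    by (auto simp: general_linear_group_def units_of_def Units_def ring_mat_simps)
  obtain a' b' c' d' where "B = mat2 a' b' c' d'"
    using B(1) by (rule carrier_mat2_cases)
  with B(2) have eqs: "a * a' + b * c' = 1" "a * b' + b * d' = 0" "c * a' + d * c' = 0" "c * b' + d * d' = 1"
    by (auto simp: mat2_mult one_mat2)
  \<comment> \<open>Multiplicativity of the determinant, with \<open>det (A * B)\<close> written in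
    the entries of the product, which is the identity here.\<close>
  have "(a * d - b * c) * (a' * d' - b' * c') =
      (a * a' + b * c') * (c * b' + d * d') - (a * b' + b * d') * (c * a' + d * c')"
    by (simp add: algebra_simps)
  thus "a * d - b * c \<noteq> 0"
    using eqs by auto
next
  assume D: "a * d - b * c \<noteq> 0"
  define e where "e = inverse (a * d - b * c)"
  have e: "e * (a * d - b * c) = 1"
    using D by (simp add: e_def)
  \<comment> \<open>The adjugate divided by the determinant.\<close>
  define B where "B = mat2 (e * d) (- e * b) (- e * c) (e * a)"
  have "mat2 a b c d * B = 1\<^sub>m 2" "B * mat2 a b c d = 1\<^sub>m 2"
    using e by (simp_all add: B_def mat2_mult one_mat2 algebra_simps)
  thus "mat2 a b c d \<in> carrier (general_linear_group TYPE('k) 2)"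
    by (auto simp: general_linear_group_def units_of_def Units_def ring_mat_simps B_def)
qed

lemma carrier_general_linear_group_subset:
  "carrier (general_linear_group TYPE('k::field) m) \<subseteq> carrier_mat m m"
  by (auto simp: general_linear_group_def units_of_def Units_def ring_mat_simps)

text \<open>Adding a scalar matrix does not change a commutator, so only the triples
  \<open>(a - d, b, c)\<close> and \<open>(a' - d', b', c')\<close> matter. The three equations are
  the vanishing of their 2 x 2 minors, that is, linear dependence of the triples.\<close>

lemma mat2_commute_iff:
  fixes a :: "'a::comm_ring_1"
  shows "mat2 a b c d * mat2 a' b' c' d' = mat2 a' b' c' d' * mat2 a b c d \<longleftrightarrow>
    b * c' = b' * c \<and> (a - d) * b' = (a' - d') * b \<and> (a - d) * c' = (a' - d') * c"
proof -
  have "(a * b' + b * d') - (a' * b + b' * d) = (a - d) * b' - (a' - d') * b"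
    by (simp add: algebra_simps)
  moreover have "(c * a' + d * c') - (c' * a + d' * c) = (a' - d') * c - (a - d) * c'"
    by (simp add: algebra_simps)
  ultimately have "a * b' + b * d' = a' * b + b' * d \<longleftrightarrow> (a - d) * b' = (a' - d') * b"
    "c * a' + d * c' = c' * a + d' * c \<longleftrightarrow> (a - d) * c' = (a' - d') * c"
    by (metis eq_iff_diff_eq_0)+
  thus ?thesis
    by (auto simp: mat2_mult mult.commute)
qed

lemma mat2_in_centre_iff:
  fixes a b c d :: "'k::field"
  assumes "a * d - b * c \<noteq> 0"
  shows "mat2 a b c d \<in> group_centre (general_linear_group TYPE('k) 2) \<longleftrightarrow> a = d \<and> b = 0 \<and> c = 0"
proof
  let ?G = "general_linear_group TYPE('k) 2"
  assume "mat2 a b c d \<in> group_centre ?G"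
  hence comm: "mat2 a b c d * y = y * mat2 a b c d" if "y \<in> carrier ?G" for y
    using that by (auto simp: group_centre_def mult_general_linear_group)
  show "a = d \<and> b = 0 \<and> c = 0"
    \<comment> \<open>Two transvections suffice as test elements: the upper one forces
      \<open>a = d\<close> and \<open>c = 0\<close>, the lower one \<open>b = 0\<close>.\<close>
    using comm[of "mat2 1 1 0 1"] comm[of "mat2 1 0 1 1"]
    by (auto simp: mat2_in_general_linear_group mat2_commute_iff)
next
  let ?G = "general_linear_group TYPE('k) 2"
  assume scalar: "a = d \<and> b = 0 \<and> c = 0"
  have "mat2 a b c d * y = y * mat2 a b c d" if "y \<in> carrier ?G" for y
    using that carrier_general_linear_group_subset[where 'k = 'k and m = 2] scalar
    by (auto simp: mat2_commute_iff elim!: carrier_mat2_cases[of y])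
  thus "mat2 a b c d \<in> group_centre ?G"
    using assms by (auto simp: group_centre_def mult_general_linear_group mat2_in_general_linear_group)
qed

section \<open>Cliques indexed by projective points\<close>

text \<open>The points \<open>(a : b : c)\<close> of the projective plane, normalised.\<close>
definition labels :: "('k::field \<times> 'k \<times> 'k) set" where
  "labels = {(a, b, c). c = 1 \<or> c = 0 \<and> (a = 1 \<or> a = 0 \<and> b = 1)}"

text \<open>Counts the roots of \<open>t^2 + a t - b\<close>. With \<open>b * c\<close> in place of
  \<open>b\<close> these are the shifts \<open>t\<close> for which the matrix with label
  \<open>(a, b, c)\<close> is singular.\<close>

definition num_roots :: "'k::field \<Rightarrow> 'k \<Rightarrow> nat" where
  "num_roots a b = card {t. t * t + a * t = b}"

fun comm_class :: "'k::field \<times> 'k \<times> 'k \<Rightarrow> 'k mat set" where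
  "comm_class (a, b, c) =
     (\<lambda>(s, t). mat2 (s * (t + a)) (s * b) (s * c) (s * t)) ` ((UNIV - {0}) \<times> {t. t * t + a * t \<noteq> b * c})"

text \<open>The nonzero factors \<open>s\<close>, \<open>s'\<close> cancel and the shifts
  \<open>t\<close>, \<open>t'\<close> drop out, so commuting means that the labels are proportional;
  normalised proportional triples coincide. This yields both the adjacency relation and the
  disjointness of the classes.\<close>

lemma comm_class_commute_iff:
  fixes i j :: "'k::field \<times> 'k \<times> 'k"
  assumes "i \<in> labels" "j \<in> labels" "x \<in> comm_class i" "y \<in> comm_class j"
  shows "x * y = y * x \<longleftrightarrow> i = j"
proof -
  obtain a b c where i: "i = (a, b, c)" by (cases i)
  obtain a' b' c' where j: "j = (a', b', c')" by (cases j)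
  obtain s t where x: "x = mat2 (s * (t + a)) (s * b) (s * c) (s * t)" "s \<noteq> 0"
    using assms(3) i by auto
  obtain s' t' where y: "y = mat2 (s' * (t' + a')) (s' * b') (s' * c') (s' * t')" "s' \<noteq> 0"
    using assms(4) j by auto
  have eq: "(s * u) * (s' * v) = (s' * w) * (s * z) \<longleftrightarrow> u * v = w * z" for u v w z
  proof -
    have "(s * u) * (s' * v) = (s * s') * (u * v)" "(s' * w) * (s * z) = (s * s') * (w * z)"
      by (simp_all add: ac_simps)
    thus ?thesis using x(2) y(2) by simp
  qed
  have diff: "s * (t + a) - s * t = s * a" "s' * (t' + a') - s' * t' = s' * a'"
    by (simp_all add: algebra_simps)
  have "x * y = y * x \<longleftrightarrow> b * c' = b' * c \<and> a * b' = a' * b \<and> a * c' = a' * c"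
    unfolding x y mat2_commute_iff diff eq ..
  also have "\<dots> \<longleftrightarrow> i = j"
    using assms(1,2) by (auto simp: labels_def i j)
  finally show ?thesis .
qed

lemma card_comm_class:
  fixes a b c :: "'k::{field,finite}"
  assumes "(a, b, c) \<in> labels"
  shows "card (comm_class (a, b, c)) = (CARD('k) - 1) * (CARD('k) - num_roots a (b * c))"
proof -
  \<comment> \<open>Whichever of \<open>c\<close>, \<open>a\<close>, \<open>b\<close> is normalised
    to 1 lets \<open>s\<close> be read off the matrix (for \<open>a\<close>, as the difference of
    the diagonal entries); the lower right entry then gives \<open>t\<close>.\<close>
  have "inj_on (\<lambda>(s, t). mat2 (s * (t + a)) (s * b) (s * c) (s * t))
      ((UNIV - {0}) \<times> {t. t * t + a * t \<noteq> b * c})"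
    using assms by (auto simp: inj_on_def labels_def distrib_left)
  hence "card (comm_class (a, b, c)) = card (UNIV - {0 :: 'k}) * card {t. t * t + a * t \<noteq> b * c}"
    by (simp add: card_image card_cartesian_product)
  also have "card (UNIV - {0 :: 'k}) = CARD('k) - 1"
    by (simp add: card_Diff_subset)
  also have "{t. t * t + a * t \<noteq> b * c} = UNIV - {t. t * t + a * t = b * c}"
    by auto
  also have "card \<dots> = CARD('k) - num_roots a (b * c)"
    by (subst card_Diff_subset) (auto simp: num_roots_def)
  finally show ?thesis .
qed

lemma pverts_commuting_graph_GL2:
  "pverts (commuting_graph (general_linear_group TYPE('k::field) 2)) = (\<Union>i\<in>labels. comm_class i)"
proof (intro Set.set_eqI iffI)
  fix x assume x: "x \<in> pverts (commuting_graph (general_linear_group TYPE('k) 2))"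
  hence "x \<in> carrier_mat 2 2"
    using carrier_general_linear_group_subset by (auto simp: commuting_graph_def)
  then obtain a b c d where abcd: "x = mat2 a b c d"
    by (rule carrier_mat2_cases)
  have det: "a * d - b * c \<noteq> 0" and nonscalar: "\<not> (a = d \<and> b = 0 \<and> c = 0)"
    using x mat2_in_centre_iff[of a d b c]
    by (auto simp: commuting_graph_def abcd mat2_in_general_linear_group)
  \<comment> \<open>The first nonzero one among \<open>c\<close>, \<open>a - d\<close>,
    \<open>b\<close>, in the order used by the normalisation in \<open>labels\<close>. The matching
    shift is \<open>d / s\<close>.\<close>
  define s where "s = (if c \<noteq> 0 then c else if a \<noteq> d then a - d else b)"
  have s: "s \<noteq> 0"
    using nonscalar by (auto simp: s_def)
  have "((a - d) / s, b / s, c / s) \<in> labels"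
    using nonscalar by (auto simp: labels_def s_def)
  moreover have "x \<in> comm_class ((a - d) / s, b / s, c / s)"
  proof -
    have "x = mat2 (s * (d / s + (a - d) / s)) (s * (b / s)) (s * (c / s)) (s * (d / s))"
      using s by (simp add: abcd field_simps)
    \<comment> \<open>Dividing the matrix by \<open>s\<close> divides its determinant by
      \<open>s * s\<close>, so it stays nonzero.\<close>
    moreover have "d / s * (d / s) + (a - d) / s * (d / s) - b / s * (c / s) = (a * d - b * c) / (s * s)"
      using s by (simp add: field_simps)
    hence "d / s * (d / s) + (a - d) / s * (d / s) \<noteq> b / s * (c / s)"
      using det s by auto
    ultimately show ?thesis
      using s by (auto intro!: image_eqI[of _ _ "(s, d / s)"])
  qed
  ultimately show "x \<in> (\<Union>i\<in>labels. comm_class i)"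
    by blast
next
  fix x :: "'k mat" assume "x \<in> (\<Union>i\<in>labels. comm_class i)"
  then obtain a b c where L: "(a, b, c) \<in> labels" and "x \<in> comm_class (a, b, c)"
    by (metis UN_E prod_cases3)
  then obtain s t where s: "s \<noteq> 0" and t: "t * t + a * t \<noteq> b * c"
    and x: "x = mat2 (s * (t + a)) (s * b) (s * c) (s * t)"
    by auto
  have "s * (t + a) * (s * t) - s * b * (s * c) = s * s * (t * t + a * t - b * c)"
    by (simp add: algebra_simps)
  also have "\<dots> \<noteq> 0"
    using s t by simp
  finally have det: "s * (t + a) * (s * t) - s * b * (s * c) \<noteq> 0" .
  have "\<not> (s * (t + a) = s * t \<and> s * b = 0 \<and> s * c = 0)"
    using L s by (auto simp: labels_def)
  thus "x \<in> pverts (commuting_graph (general_linear_group TYPE('k) 2))"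
    using det mat2_in_centre_iff[OF det]
    by (simp add: commuting_graph_def x mat2_in_general_linear_group)
qed

lemma parcs_commuting_graph:
  "(x, y) \<in> parcs (commuting_graph G) \<longleftrightarrow>
    x \<in> pverts (commuting_graph G) \<and> y \<in> pverts (commuting_graph G) \<and> x \<noteq> y \<and> x \<otimes>\<^bsub>G\<^esub> y = y \<otimes>\<^bsub>G\<^esub> x"
  by (auto simp: commuting_graph_def)

section \<open>Counting monic quadratics by their number of roots\<close>

lemma quadratic_roots_iff:
  fixes a u t :: "'k::field"
  shows "t * t + a * t = u * u + a * u \<longleftrightarrow> t = u \<or> t = - a - u"
proof -
  have "t * t + a * t - (u * u + a * u) = (t - u) * (t - (- a - u))"
    by (simp add: algebra_simps)
  thus ?thesis
    by (metis eq_iff_diff_eq_0 mult_eq_0_iff)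
qed

text \<open>If \<open>u\<close> is a root then, the roots having sum \<open>- a\<close>, the other
  one is \<open>- a - u\<close>. The condition for a double root is written with
  \<open>u + u\<close>, so that it is correct in characteristic 2 as well.\<close>

lemma num_roots_factorization:
  fixes a u :: "'k::field"
  shows "num_roots a (u * u + a * u) = (if a = - (u + u) then 1 else 2)"
proof -
  have "{t. t * t + a * t = u * u + a * u} = {u, - a - u}"
    by (auto simp: quadratic_roots_iff)
  moreover have "u = - a - u \<longleftrightarrow> a = - (u + u)"
    by (metis add.commute add_diff_cancel_right' diff_add_cancel minus_add_distrib minus_diff_eq)
  ultimately show ?thesis
    by (auto simp: num_roots_def)
qed

lemma num_roots_cases:
  fixes a b :: "'k::{field,finite}"
  obtains "num_roots a b = 0" "\<And>t. t * t + a * t \<noteq> b"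
  | u where "b = u * u + a * u" "num_roots a b = (if a = - (u + u) then 1 else 2)"
proof (cases "\<exists>u. u * u + a * u = b")
  case True
  then obtain u where "b = u * u + a * u" by auto
  thus ?thesis using that(2) num_roots_factorization by metis
next
  case False
  thus ?thesis using that(1) by (simp add: num_roots_def)
qed

lemma num_roots_le: "num_roots (a :: 'k::{field,finite}) b \<in> {0, 1, 2}"
  by (rule num_roots_cases[of a b]) auto

definition quadratics :: "nat \<Rightarrow> ('k::field \<times> 'k) set" where
  "quadratics r = {(a, b). num_roots a b = r}"

text \<open>The values of \<open>f\<close> lie in an arbitrary commutative monoid, so that the lemma
  serves both for counting and for adding up multisets of eigenvalues.\<close>

lemma sum_num_roots:
  fixes f :: "nat \<Rightarrow> 'b::comm_monoid_add"
  shows "(\<Sum>(a, b)\<in>(UNIV :: ('k::{field,finite} \<times> 'k) set). f (num_roots a b)) =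
    (\<Sum>r\<in>{0, 1, 2}. \<Sum>_\<in>(quadratics r :: ('k \<times> 'k) set). f r)"
proof -
  define g :: "'k \<times> 'k \<Rightarrow> nat" where "g = (\<lambda>(a, b). num_roots a b)"
  have "g x \<in> {0, 1, 2}" for x
    unfolding g_def case_prod_beta by (rule num_roots_le)
  hence "range g \<subseteq> {0, 1, 2}"
    by (simp add: image_subset_iff)
  hence "(\<Sum>x\<in>UNIV. f (g x)) = (\<Sum>r\<in>{0, 1, 2}. \<Sum>x | x \<in> UNIV \<and> g x = r. f (g x))"
    by (intro sum.group[symmetric]) auto
  also have "\<dots> = (\<Sum>r\<in>{0, 1, 2}. \<Sum>_\<in>(quadratics r :: ('k \<times> 'k) set). f r)"
    by (intro sum.cong) (auto simp: quadratics_def g_def)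
  finally show ?thesis
    by (simp add: g_def case_prod_beta)
qed

text \<open>The quadratics with exactly one root are the squares of \<open>t - u\<close>, one for
  each field element \<open>u\<close>.\<close>

lemma card_quadratics_1: "card (quadratics 1 :: ('k::{field,finite} \<times> 'k) set) = CARD('k)"
proof -
  have "{(a :: 'k, b). num_roots a b = 1} = range (\<lambda>u. (- (u + u), - (u * u)))"
  proof (intro Set.set_eqI iffI)
    fix x :: "'k \<times> 'k" assume "x \<in> {(a, b). num_roots a b = 1}"
    then obtain a b where x: "x = (a, b)" "num_roots a b = 1" by auto
    from num_roots_cases[of a b] x(2) obtain u where "b = u * u + a * u" "a = - (u + u)"
      by (metis numeral_eq_one_iff semiring_norm(85) zero_neq_one)
    thus "x \<in> range (\<lambda>u. (- (u + u), - (u * u)))"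
      by (auto simp: x algebra_simps)
  next
    fix x :: "'k \<times> 'k" assume "x \<in> range (\<lambda>u. (- (u + u), - (u * u)))"
    then obtain u where "x = (- (u + u), - (u * u))" by auto
    thus "x \<in> {(a, b). num_roots a b = 1}"
      using num_roots_factorization[of "- (u + u)" u] by (simp add: algebra_simps)
  qed
  moreover have "inj (\<lambda>u :: 'k. (- (u + u), - (u * u)))"
  proof (rule injI)
    fix u v :: 'k assume "(- (u + u), - (u * u)) = (- (v + v), - (v * v))"
    hence *: "u + u = v + v" "u * u = v * v" by (auto simp del: minus_add_distrib)
    \<comment> \<open>Neither coefficient alone determines \<open>u\<close> in every characteristic:
      \<open>u + u\<close> vanishes in characteristic 2, and \<open>u * u\<close> loses the sign
      otherwise. Together they give that \<open>u - v\<close> squares to zero.\<close>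
    have "(u - v) * (u - v) = u * u - (u + u) * v + v * v"
      by (simp add: algebra_simps)
    also have "\<dots> = 0"
      unfolding * by (simp add: algebra_simps)
    finally show "u = v" by simp
  qed
  ultimately show ?thesis
    by (simp add: quadratics_def card_image)
qed

text \<open>The first equation counts all pairs of coefficients. The second counts pairs of a
  quadratic and one of its roots: \<open>a\<close> and the root \<open>t\<close> are free and
  determine the constant term.\<close>

lemma sum_card_quadratics:
  fixes Q :: "nat \<Rightarrow> ('k::{field,finite} \<times> 'k) set"
  defines "Q \<equiv> quadratics"
  shows "card (Q 0) + card (Q 1) + card (Q 2) = CARD('k) * CARD('k)"
    and "card (Q 1) + 2 * card (Q 2) = CARD('k) * CARD('k)"
proof -
  have "(\<Sum>(a, b)\<in>(UNIV :: ('k \<times> 'k) set). 1) = CARD('k) * CARD('k)"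
    by (simp add: case_prod_beta)
  thus "card (Q 0) + card (Q 1) + card (Q 2) = CARD('k) * CARD('k)"
    using sum_num_roots[where 'k = 'k, of "\<lambda>_. 1::nat"] by (simp add: Q_def)
  have "(\<Sum>(a, b)\<in>(UNIV :: ('k \<times> 'k) set). num_roots a b) =
      card (SIGMA x : (UNIV :: ('k \<times> 'k) set). {t. t * t + fst x * t = snd x})"
    by (subst card_SigmaI) (auto simp: num_roots_def case_prod_beta)
  also have "\<dots> = card (range (\<lambda>(a :: 'k, t). ((a, t * t + a * t), t)))"
    by (intro arg_cong[of _ _ card]) (auto simp: image_iff)
  also have "\<dots> = CARD('k \<times> 'k)"
    by (subst card_image) (auto simp: inj_on_def)
  finally show "card (Q 1) + 2 * card (Q 2) = CARD('k) * CARD('k)"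
    using sum_num_roots[where 'k = 'k, of "\<lambda>r. r"] by (simp add: Q_def)
qed

section \<open>Multiset arithmetic and summation over the labels\<close>

lemma sum_mset_constant: "(\<Sum>_\<in>S. M) = repeat_mset (card S) (M :: 'a multiset)"
  by (induction S rule: infinite_finite_induct) auto

lemma replicate_mset_add: "replicate_mset (m + n) x = replicate_mset m x + replicate_mset n x"
  by (rule multiset_eqI) simp

lemma repeat_mset_replicate_mset_mult:
  "repeat_mset m (replicate_mset n x) = replicate_mset (m * n) x"
  by (rule multiset_eqI) simp

text \<open>The projective plane splits into the points with \<open>c = 1\<close>, which run over
  all quadratics, the points with \<open>c = 0\<close> and \<open>a = 1\<close>, where
  \<open>t^2 + t\<close> has two roots, and the single point \<open>(0, 1, 0)\<close>, where
  \<open>t^2\<close> has one.\<close>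

lemma sum_labels:
  fixes f :: "nat \<Rightarrow> 'b::comm_monoid_add"
  shows "(\<Sum>(a, b, c)\<in>(labels :: ('k::{field,finite} \<times> 'k \<times> 'k) set). f (num_roots a (b * c))) =
    (\<Sum>(a, b)\<in>(UNIV :: ('k \<times> 'k) set). f (num_roots a b)) + (\<Sum>_\<in>(UNIV :: 'k set). f 2) + f 1"
proof -
  let ?g = "\<lambda>(a :: 'k, b, c). f (num_roots a (b * c))"
  let ?X = "range (\<lambda>(a :: 'k, b :: 'k). (a, b, 1 :: 'k))"
  let ?Y = "range (\<lambda>b :: 'k. (1 :: 'k, b, 0 :: 'k))"
  let ?Z = "{(0 :: 'k, 1 :: 'k, 0 :: 'k)}"
  have "labels = ?X \<union> ?Y \<union> ?Z"
    by (auto simp: labels_def image_iff)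
  hence "sum ?g labels = sum ?g (?X \<union> ?Y \<union> ?Z)"
    by (rule arg_cong)
  also have "\<dots> = sum ?g (?X \<union> ?Y) + sum ?g ?Z"
    by (rule sum.union_disjoint) auto
  also have "sum ?g (?X \<union> ?Y) = sum ?g ?X + sum ?g ?Y"
    by (rule sum.union_disjoint) auto
  finally have "sum ?g labels = sum ?g ?X + sum ?g ?Y + sum ?g ?Z" .
  moreover have "sum ?g ?X = (\<Sum>(a, b)\<in>(UNIV :: ('k \<times> 'k) set). f (num_roots a b))"
    by (subst sum.reindex) (auto simp: inj_on_def case_prod_beta)
  moreover have "sum ?g ?Y = (\<Sum>_\<in>(UNIV :: 'k set). f 2)"
    using num_roots_factorization[of "1 :: 'k" 0]
    by (subst sum.reindex) (auto simp: inj_on_def intro!: sum.cong)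
  moreover have "sum ?g ?Z = f 1"
    using num_roots_factorization[of "0 :: 'k" 0] by simp
  ultimately show ?thesis
    by simp
qed

section \<open>Assembling the spectrum of the commuting graph\<close>

theorem proposition2p6:
  fixes p n q :: nat
  assumes "prime p" and "n > 0" and "q = p ^ n" and "q > 2"
    and "card (UNIV :: 'k::{field,finite} set) = q"
  shows "graph_spectrum (commuting_graph (general_linear_group TYPE('k) 2)) =
      replicate_mset (q ^ 4 - q ^ 3 - 2 * q ^ 2 - q) (- 1)
    + replicate_mset (q * (q + 1) div 2) (of_nat q ^ 2 - 3 * of_nat q + 1)
    + replicate_mset (q * (q - 1) div 2) (of_nat q ^ 2 - of_nat q - 1)
    + replicate_mset (q + 1) (of_nat q ^ 2 - 2 * of_nat q)"
proof -
  let ?\<Gamma> = "commuting_graph (general_linear_group TYPE('k) 2)"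
  \<comment> \<open>The spectrum of a clique whose quadratic has \<open>r\<close> roots.\<close>
  define F :: "nat \<Rightarrow> complex multiset" where
    "F r = add_mset (of_nat ((q - 1) * (q - r)) - 1) (replicate_mset ((q - 1) * (q - r) - 1) (- 1))" for r
  define Q :: "nat \<Rightarrow> ('k \<times> 'k) set" where "Q = quadratics"
  have card_class: "card (comm_class (a, b, c)) = (q - 1) * (q - num_roots a (b * c))"
    if "(a, b, c) \<in> labels" for a b c :: 'k
    using card_comm_class[OF that] assms(5) by simp
  have nonempty: "comm_class i \<noteq> {}" if "i \<in> labels" for i :: "'k \<times> 'k \<times> 'k"
  proof -
    obtain a b c where i: "i = (a, b, c)" by (cases i)
    have "num_roots a (b * c) \<le> 2"
      using num_roots_le[of a "b * c"] by auto
    \<comment> \<open>Here \<open>q > 2\<close> is essential: for \<open>q = 2\<close> a label with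
      two roots would have an empty class.\<close>
    hence "card (comm_class i) > 0"
      using card_class[of a b c] that i assms(4) by simp
    thus ?thesis by auto
  qed
  have "graph_spectrum ?\<Gamma> = (\<Sum>i\<in>(labels :: ('k \<times> 'k \<times> 'k) set).
      add_mset (of_nat (card (comm_class i)) - 1) (replicate_mset (card (comm_class i) - 1) (- 1)))"
  proof (rule graph_spectrum_disjoint_cliques)
    show "finite (comm_class i)" for i :: "'k \<times> 'k \<times> 'k"
      by (cases i) simp
    show "comm_class i \<inter> comm_class j = {}" if "i \<in> labels" "j \<in> labels" "i \<noteq> j"
      for i j :: "'k \<times> 'k \<times> 'k"
      \<comment> \<open>A common element commutes with itself, which would force
        \<open>i = j\<close>.\<close>
      using comm_class_commute_iff[OF that(1,2)] that(3) by blast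
    show "(x, y) \<in> parcs ?\<Gamma> \<longleftrightarrow> i = j \<and> x \<noteq> y"
      if "i \<in> labels" "j \<in> labels" "x \<in> comm_class i" "y \<in> comm_class j"
      for i j :: "'k \<times> 'k \<times> 'k" and x y
      using comm_class_commute_iff[OF that] that
      by (auto simp: parcs_commuting_graph pverts_commuting_graph_GL2 mult_general_linear_group)
  qed (simp_all add: nonempty pverts_commuting_graph_GL2)
  also have "\<dots> = (\<Sum>(a, b, c)\<in>(labels :: ('k \<times> 'k \<times> 'k) set). F (num_roots a (b * c)))"
    by (intro sum.cong) (auto simp: card_class F_def simp del: comm_class.simps)
  \<comment> \<open>The extra \<open>1\<close> and \<open>q\<close> are the cliques of the labels
    with \<open>c = 0\<close>.\<close>
  also have "\<dots> = repeat_mset (card (Q 0)) (F 0) + repeat_mset (card (Q 1) + 1) (F 1) +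
      repeat_mset (card (Q 2) + q) (F 2)"
    unfolding sum_labels sum_num_roots sum_mset_constant Q_def
    by (simp add: assms(5) repeat_mset_distrib ac_simps)
  finally have spectrum: "graph_spectrum ?\<Gamma> = \<dots>" .

  have Q1: "card (Q 1) = q"
    using card_quadratics_1[where 'k = 'k] assms(5) by (simp add: Q_def)
  have "card (Q 0) + card (Q 1) + card (Q 2) = q * q" "card (Q 1) + 2 * card (Q 2) = q * q"
    using sum_card_quadratics[where 'k = 'k] assms(5) by (simp_all add: Q_def)
  hence Q0: "2 * card (Q 0) = q * (q - 1)" and Q2: "2 * (card (Q 2) + q) = q * (q + 1)"
    using Q1 by (simp_all add: algebra_simps diff_mult_distrib2)
  \<comment> \<open>Writing \<open>q = k + 3\<close> turns the truncated differences on naturals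
    into polynomials in \<open>k\<close> with nonnegative coefficients.\<close>
  define k where "k = q - 3"
  have q: "q = k + 3"
    using assms(4) by (simp add: k_def)
  \<comment> \<open>The total multiplicity contributed to \<open>- 1\<close>: one less than its size
    for every clique. It is computed doubled below, because the numbers of cliques are known through
    \<open>Q0\<close> and \<open>Q2\<close> only as halves.\<close>
  let ?N = "card (Q 0) * (q * (q - 1) - 1) + (q + 1) * ((q - 1) * (q - 1) - 1) +
    (card (Q 2) + q) * ((q - 1) * (q - 2) - 1)"
  have sizes: "q * (q - 1) - 1 = k * k + 5 * k + 5" "(q - 1) * (q - 1) - 1 = k * k + 4 * k + 3"
    "(q - 1) * (q - 2) - 1 = k * k + 3 * k + 1"
    by (simp_all add: q algebra_simps)
  have double: "2 * (x * a + y * b + z * c) = (2 * x) * a + 2 * y * b + (2 * z) * c" for x y z a b c :: nat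
    by (simp add: algebra_simps)
  have "2 * ?N = (2 * card (Q 0)) * (q * (q - 1) - 1) + 2 * (q + 1) * ((q - 1) * (q - 1) - 1) +
      (2 * (card (Q 2) + q)) * ((q - 1) * (q - 2) - 1)"
    by (rule double)
  also have "\<dots> = (k + 3) * (k + 2) * (k * k + 5 * k + 5) + 2 * (k + 4) * (k * k + 4 * k + 3) +
      (k + 3) * (k + 4) * (k * k + 3 * k + 1)"
    unfolding Q0 Q2 sizes by (simp add: q add.commute)
  finally have total: "2 * (?N + q ^ 3 + 2 * q ^ 2 + q) = 2 * q ^ 4"
    by (simp add: q algebra_simps power2_eq_square power3_eq_cube power4_eq_xxxx)
  \<comment> \<open>The additive form of the identity ensures that none of the truncated
    subtractions in the claimed exponent cuts off.\<close>
  have "M = d - a - b - c" if "2 * (M + a + b + c) = 2 * d" for M a b c d :: nat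
    using that by simp
  from this[OF total] have N: "?N = q ^ 4 - q ^ 3 - 2 * q ^ 2 - q" .
  have "of_nat ((q - 1) * (q - 0)) - 1 = (of_nat q ^ 2 - of_nat q - 1 :: complex)"
    "of_nat ((q - 1) * (q - 1)) - 1 = (of_nat q ^ 2 - 2 * of_nat q :: complex)"
    "of_nat ((q - 1) * (q - 2)) - 1 = (of_nat q ^ 2 - 3 * of_nat q + 1 :: complex)"
    by (simp_all add: q algebra_simps power2_eq_square)
  hence F: "F 0 = add_mset (of_nat q ^ 2 - of_nat q - 1) (replicate_mset (q * (q - 1) - 1) (- 1))"
    "F 1 = add_mset (of_nat q ^ 2 - 2 * of_nat q) (replicate_mset ((q - 1) * (q - 1) - 1) (- 1))"
    "F 2 = add_mset (of_nat q ^ 2 - 3 * of_nat q + 1) (replicate_mset ((q - 1) * (q - 2) - 1) (- 1))"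
    unfolding F_def by (simp_all add: mult.commute)
  have "graph_spectrum ?\<Gamma> = replicate_mset ?N (- 1) +
      replicate_mset (card (Q 2) + q) (of_nat q ^ 2 - 3 * of_nat q + 1) +
      replicate_mset (card (Q 0)) (of_nat q ^ 2 - of_nat q - 1) +
      replicate_mset (q + 1) (of_nat q ^ 2 - 2 * of_nat q)"
    unfolding spectrum F Q1 repeat_mset_distrib_add_mset repeat_mset_replicate_mset_mult
    by (simp only: replicate_mset_add ac_simps)
  moreover have "card (Q 2) + q = q * (q + 1) div 2" "card (Q 0) = q * (q - 1) div 2"
    unfolding Q0[symmetric] Q2[symmetric] by simp_all
  ultimately show ?thesis
    unfolding N by simp
qed

end
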